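(* The hypergraphs $S_6^{12}$ and $S_4^{8}$ (defined in the context) are properly $2$-colorable.
   Context: A hypergraph is properly $2$-colorable if its vertices can be colored with the colors Red and Blue so that every hyperedge contains both a Red vertex and a Blue vertex. The hypergraphs $S_6^{12}$ and $S_4^{8}$ are the paper's explicit constructions of the Steiner systems $S(5,6,12)$ and $S(3,4,8)$. (A Steiner system $S(t,k,n)$ is a set of $n$ points with a collection of $k$-subsets, called blocks, such that every $t$-subset is contained in exactly one block; it is viewed as a $k$-uniform hypergraph whose hyperedges are the blocks.) For a hypergraph on vertex set $V$, the complementary hyperedge of $e\subset V$ is $V\setminus e$. Definition of $S_4^{8}$. The vertex set is $V_4^8=\{v_1,\dots,v_8\}$. The hyperedges are the following $4$-subsets together with the complementary hyperedge of each of them: $\{v_1,v_2,v_3,v_4\}$; and all sets $A\cup p$ with $p\in B$, where $(A,B)$ is one of $A=\{v_1,v_2\}$, $B=\{\{v_5,v_6\},\{v_7,v_8\}\}$; $A=\{v_1,v_3\}$, $B=\{\{v_5,v_7\},\{v_6,v_8\}\}$; $A=\{v_1,v_4\}$, $B=\{\{v_5,v_8\},\{v_6,v_7\}\}$. Definition of $S_6^{12}$. The vertex set is $V_6^{12}=\{v_1,\dots,v_{12}\}$. The hyperedges are the $6$-subsets in (1)-(4) below together with the complementary hyperedge of each of them. (1) $\{v_1,v_2,v_3,v_4,v_5,v_6\}$. (2) All sets $A\cup p$ with $p\in B$, where $(A,B)$ is one of the ten pairs: $A=\{v_1,v_2,v_3,v_4\}$, $B=\{\{v_7,v_8\},\{v_9,v_{10}\},\{v_{11},v_{12}\}\}$;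 $A=\{v_1,v_2,v_3,v_5\}$, $B=\{\{v_7,v_9\},\{v_8,v_{11}\},\{v_{10},v_{12}\}\}$; $A=\{v_1,v_2,v_3,v_6\}$, $B=\{\{v_7,v_{12}\},\{v_8,v_{10}\},\{v_9,v_{11}\}\}$; $A=\{v_1,v_2,v_4,v_5\}$, $B=\{\{v_7,v_{11}\},\{v_8,v_{10}\},\{v_9,v_{12}\}\}$; $A=\{v_1,v_3,v_4,v_5\}$, $B=\{\{v_7,v_{12}\},\{v_8,v_9\},\{v_{10},v_{11}\}\}$; $A=\{v_1,v_2,v_4,v_6\}$, $B=\{\{v_7,v_9\},\{v_8,v_{12}\},\{v_{10},v_{11}\}\}$; $A=\{v_1,v_2,v_5,v_6\}$, $B=\{\{v_7,v_{10}\},\{v_8,v_9\},\{v_{11},v_{12}\}\}$; $A=\{v_1,v_3,v_4,v_6\}$, $B=\{\{v_7,v_{10}\},\{v_8,v_{11}\},\{v_9,v_{12}\}\}$; $A=\{v_1,v_3,v_5,v_6\}$, $B=\{\{v_7,v_{11}\},\{v_9,v_{10}\},\{v_8,v_{12}\}\}$; $A=\{v_1,v_4,v_5,v_6\}$, $B=\{\{v_7,v_8\},\{v_9,v_{11}\},\{v_{10},v_{12}\}\}$. (3) All sets $A\cup q$ with $q\in B$, where $(A,B)$ is one of the ten pairs: $A=\{v_1,v_2,v_3\}$, $B=\{\{v_7,v_{10},v_{11}\},\{v_8,v_9,v_{12}\}\}$; $A=\{v_1,v_2,v_4\}$, $B=\{\{v_7,v_{10},v_{12}\},\{v_8,v_9,v_{11}\}\}$;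 $A=\{v_1,v_2,v_5\}$, $B=\{\{v_7,v_8,v_{12}\},\{v_9,v_{10},v_{11}\}\}$; $A=\{v_1,v_2,v_6\}$, $B=\{\{v_7,v_8,v_{11}\},\{v_9,v_{10},v_{12}\}\}$; $A=\{v_1,v_3,v_4\}$, $B=\{\{v_7,v_9,v_{11}\},\{v_8,v_{10},v_{12}\}\}$; $A=\{v_1,v_3,v_5\}$, $B=\{\{v_7,v_8,v_{10}\},\{v_9,v_{11},v_{12}\}\}$; $A=\{v_1,v_3,v_6\}$, $B=\{\{v_7,v_8,v_9\},\{v_{10},v_{11},v_{12}\}\}$; $A=\{v_1,v_4,v_5\}$, $B=\{\{v_7,v_9,v_{10}\},\{v_8,v_{11},v_{12}\}\}$; $A=\{v_1,v_4,v_6\}$, $B=\{\{v_7,v_{11},v_{12}\},\{v_8,v_9,v_{10}\}\}$; $A=\{v_1,v_5,v_6\}$, $B=\{\{v_7,v_9,v_{12}\},\{v_8,v_{10},v_{11}\}\}$. (4) All sets $A\cup r$ with $r\in B$, where $(A,B)$ is one of the five pairs: $A=\{v_1,v_2\}$, $B=\{\{v_7,v_8,v_9,v_{10}\},\{v_7,v_9,v_{11},v_{12}\},\{v_8,v_{10},v_{11},v_{12}\}\}$; $A=\{v_1,v_3\}$, $B=\{\{v_7,v_8,v_{11},v_{12}\},\{v_8,v_9,v_{10},v_{11}\},\{v_7,v_9,v_{10},v_{12}\}\}$; $A=\{v_1,v_4\}$, $B=\{\{v_7,v_8,v_9,v_{12}\},\{v_7,v_8,v_{10},v_{11}\},\{v_9,v_{10},v_{11},v_{12}\}\}$;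 $A=\{v_1,v_5\}$, $B=\{\{v_7,v_8,v_9,v_{11}\},\{v_8,v_9,v_{10},v_{12}\},\{v_7,v_{10},v_{11},v_{12}\}\}$; $A=\{v_1,v_6\}$, $B=\{\{v_7,v_8,v_{10},v_{12}\},\{v_7,v_9,v_{10},v_{11}\},\{v_8,v_9,v_{11},v_{12}\}\}$. *)

theory Defs
  imports Main
begin

type_synonym 'a hypergraph = "'a set \<times> 'a set set"

datatype color = Red | Blue

definition proper_2_coloring :: "'a hypergraph \<Rightarrow> ('a \<Rightarrow> color) \<Rightarrow> bool" where
  "proper_2_coloring H c \<longleftrightarrow>
     (\<forall>e\<in>snd H. (\<exists>x\<in>e. c x = Red) \<and> (\<exists>x\<in>e. c x = Blue))"

(* A coloring is a total function on the ambient type. Only its values on the vertices matter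
   when every hyperedge is a subset of the vertex set, which is the case for the two
   hypergraphs below (lemmas S_4_8_edges and S_6_12_edges). *)
definition properly_2_colorable :: "'a hypergraph \<Rightarrow> bool" where
  "properly_2_colorable H \<longleftrightarrow> (\<exists>c. proper_2_coloring H c)"

definition joins :: "('a set \<times> 'a set set) set \<Rightarrow> 'a set set" where
  "joins P = {A \<union> p | A B p. (A, B) \<in> P \<and> p \<in> B}"

definition with_complements :: "'a set \<Rightarrow> 'a set set \<Rightarrow> 'a set set" where
  "with_complements V F = F \<union> (\<lambda>e. V - e) ` F"

(* The vertex v_i is represented by the natural number i. *)

definition V_4_8 :: "nat set" where
  "V_4_8 = {1..8}"

definition S_4_8 :: "nat hypergraph" where
  "S_4_8 = (V_4_8, with_complements V_4_8 (insert {1,2,3,4} (joins {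
    ({1,2}, {{5,6}, {7,8}}),
    ({1,3}, {{5,7}, {6,8}}),
    ({1,4}, {{5,8}, {6,7}})})))"

definition V_6_12 :: "nat set" where
  "V_6_12 = {1..12}"

definition pairs_6_12_tetrads :: "(nat set \<times> nat set set) set" where
  "pairs_6_12_tetrads = {
    ({1,2,3,4}, {{7,8}, {9,10}, {11,12}}),
    ({1,2,3,5}, {{7,9}, {8,11}, {10,12}}),
    ({1,2,3,6}, {{7,12}, {8,10}, {9,11}}),
    ({1,2,4,5}, {{7,11}, {8,10}, {9,12}}),
    ({1,3,4,5}, {{7,12}, {8,9}, {10,11}}),
    ({1,2,4,6}, {{7,9}, {8,12}, {10,11}}),
    ({1,2,5,6}, {{7,10}, {8,9}, {11,12}}),
    ({1,3,4,6}, {{7,10}, {8,11}, {9,12}}),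
    ({1,3,5,6}, {{7,11}, {9,10}, {8,12}}),
    ({1,4,5,6}, {{7,8}, {9,11}, {10,12}})}"

definition pairs_6_12_triads :: "(nat set \<times> nat set set) set" where
  "pairs_6_12_triads = {
    ({1,2,3}, {{7,10,11}, {8,9,12}}),
    ({1,2,4}, {{7,10,12}, {8,9,11}}),
    ({1,2,5}, {{7,8,12}, {9,10,11}}),
    ({1,2,6}, {{7,8,11}, {9,10,12}}),
    ({1,3,4}, {{7,9,11}, {8,10,12}}),
    ({1,3,5}, {{7,8,10}, {9,11,12}}),
    ({1,3,6}, {{7,8,9}, {10,11,12}}),
    ({1,4,5}, {{7,9,10}, {8,11,12}}),
    ({1,4,6}, {{7,11,12}, {8,9,10}}),
    ({1,5,6}, {{7,9,12}, {8,10,11}})}"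

definition pairs_6_12_dyads :: "(nat set \<times> nat set set) set" where
  "pairs_6_12_dyads = {
    ({1,2}, {{7,8,9,10}, {7,9,11,12}, {8,10,11,12}}),
    ({1,3}, {{7,8,11,12}, {8,9,10,11}, {7,9,10,12}}),
    ({1,4}, {{7,8,9,12}, {7,8,10,11}, {9,10,11,12}}),
    ({1,5}, {{7,8,9,11}, {8,9,10,12}, {7,10,11,12}}),
    ({1,6}, {{7,8,10,12}, {7,9,10,11}, {8,9,11,12}})}"

definition S_6_12 :: "nat hypergraph" where
  "S_6_12 = (V_6_12, with_complements V_6_12
     ({{1,2,3,4,5,6}} \<union> joins pairs_6_12_tetrads \<union> joins pairs_6_12_triads
       \<union> joins pairs_6_12_dyads))"

lemma S_4_8_edges: "snd S_4_8 \<subseteq> Pow (fst S_4_8)"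
  by (auto simp: S_4_8_def V_4_8_def with_complements_def joins_def)

lemma S_6_12_edges: "snd S_6_12 \<subseteq> Pow (fst S_6_12)"
  by (auto simp: S_6_12_def V_6_12_def with_complements_def joins_def
      pairs_6_12_tetrads_def pairs_6_12_triads_def pairs_6_12_dyads_def)

end

(* In a k-uniform hypergraph on 2k vertices that is closed under complements, every k-set R that is
   not a hyperedge gives a proper 2-coloring: color R Red and the other vertices Blue. No hyperedge
   equals R or its complement, so by size none lies inside either color class.
   Here R = {1,2,3,4,5,7}, respectively R = {1,2,3,5}: it shares all but one of its points with the
   block {1,2,3,4,5,6}, respectively {1,2,3,4}, and distinct blocks of the Steiner system share fewer
   points. Since R and all the listed blocks contain the point 1, only R itself, not its complement,
   has to be compared with the list. *)

theory Submission
  imports Defs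
begin

text \<open>The four conditions on \<open>e\<close> also settle its complement: \<open>V - e\<close>
  meets \<open>R\<close> because \<open>e\<close> does not contain \<open>R\<close>, and it leaves
  \<open>R\<close> because \<open>e\<close> and \<open>R\<close> together do not cover
  \<open>V\<close>.\<close>

lemma with_complements_2_colorable:
  assumes "R \<subseteq> V"
    and "\<And>e. e \<in> F \<Longrightarrow> e \<subseteq> V \<and> \<not> e \<subseteq> R \<and> \<not> R \<subseteq> e \<and> e \<inter> R \<noteq> {} \<and> e \<union> R \<noteq> V"
  shows "properly_2_colorable (V, with_complements V F)"
proof -
  have "proper_2_coloring (V, with_complements V F) (\<lambda>x. if x \<in> R then Red else Blue)"
    unfolding proper_2_coloring_def
  proof
    fix e assume "e \<in> snd (V, with_complements V F)"
    then obtain f where f: "f \<in> F" "e = f \<or> e = V - f"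
      by (auto simp: with_complements_def)
    have "e \<inter> R \<noteq> {} \<and> e - R \<noteq> {}"
      using assms(1) assms(2)[OF f(1)] f(2) by blast
    then show "(\<exists>x\<in>e. (if x \<in> R then Red else Blue) = Red)
        \<and> (\<exists>x\<in>e. (if x \<in> R then Red else Blue) = Blue)"
      by auto
  qed
  then show ?thesis
    unfolding properly_2_colorable_def by blast
qed

lemma uniform_2_colorable:
  assumes V: "finite V" "R \<subseteq> V" "card V = 2 * card R" and x: "x \<in> R"
    and F: "\<forall>e\<in>F. e \<subseteq> V \<and> card e = card R \<and> x \<in> e \<and> \<not> e \<subseteq> R"
  shows "properly_2_colorable (V, with_complements V F)"
proof (rule with_complements_2_colorable[OF V(2)])
  fix e assume "e \<in> F"
  with F have e: "e \<subseteq> V" "card e = card R" "x \<in> e" "\<not> e \<subseteq> R"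
    by auto
  have fin: "finite e" "finite R"
    using e(1) V(1,2) finite_subset by auto
  have "\<not> R \<subseteq> e"
    using e(2,4) fin card_subset_eq[of e R] by auto
  moreover have "e \<inter> R \<noteq> {}"
    using e(3) x by blast
  \<comment> \<open>As \<open>e\<close> and \<open>R\<close> share \<open>x\<close>, their union has
    fewer than \<open>2 * card R\<close> points.\<close>
  moreover have "e \<union> R \<noteq> V"
    using card_Un_Int[OF fin] e(2) V(3) fin \<open>e \<inter> R \<noteq> {}\<close> by auto
  ultimately show "e \<subseteq> V \<and> \<not> e \<subseteq> R \<and> \<not> R \<subseteq> e \<and> e \<inter> R \<noteq> {} \<and> e \<union> R \<noteq> V"
    using e(1,4) by blast
qed

text \<open>Reduces a claim about all blocks of a family to finitely many checks on its explicit
  table, which simplification can evaluate.\<close>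

lemma ball_joins: "(\<forall>e\<in>joins P. Q e) \<longleftrightarrow> (\<forall>(A, B)\<in>P. \<forall>p\<in>B. Q (A \<union> p))"
  unfolding joins_def by blast

lemma S_4_8_2_colorable: "properly_2_colorable S_4_8"
  unfolding S_4_8_def
proof (rule uniform_2_colorable[where R = "{1,2,3,5}" and x = 1])
  show "\<forall>e\<in>insert {1,2,3,4} (joins {
    ({1,2}, {{5,6}, {7,8}}), ({1,3}, {{5,7}, {6,8}}), ({1,4}, {{5,8}, {6,7}})}).
      e \<subseteq> V_4_8 \<and> card e = card {1,2,3,5::nat} \<and> 1 \<in> e \<and> \<not> e \<subseteq> {1,2,3,5}"
    unfolding ball_joins ball_simps by (simp add: V_4_8_def)
qed (simp_all add: V_4_8_def)

lemma S_6_12_2_colorable: "properly_2_colorable S_6_12"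
  unfolding S_6_12_def
proof (rule uniform_2_colorable[where R = "{1,2,3,4,5,7}" and x = 1])
  let ?Q = "\<lambda>e. e \<subseteq> V_6_12 \<and> card e = card {1,2,3,4,5,7::nat} \<and> 1 \<in> e \<and> \<not> e \<subseteq> {1,2,3,4,5,7}"
  have "\<forall>e\<in>joins pairs_6_12_tetrads. ?Q e"
    unfolding ball_joins by (simp add: pairs_6_12_tetrads_def V_6_12_def)
  moreover have "\<forall>e\<in>joins pairs_6_12_triads. ?Q e"
    unfolding ball_joins by (simp add: pairs_6_12_triads_def V_6_12_def)
  moreover have "\<forall>e\<in>joins pairs_6_12_dyads. ?Q e"
    unfolding ball_joins by (simp add: pairs_6_12_dyads_def V_6_12_def)
  moreover have "?Q {1,2,3,4,5,6}"
    by (simp add: V_6_12_def)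
  ultimately show "\<forall>e\<in>{{1,2,3,4,5,6}} \<union> joins pairs_6_12_tetrads \<union> joins pairs_6_12_triads
      \<union> joins pairs_6_12_dyads. ?Q e"
    by (simp only: ball_Un ball_simps simp_thms)
qed (simp_all add: V_6_12_def)

theorem lemma1:
  shows "properly_2_colorable S_6_12 \<and> properly_2_colorable S_4_8"
  using S_6_12_2_colorable S_4_8_2_colorable by blast

end
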